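(* Let $(R,\mathfrak m,k)$ be a regular Noetherian local ring of dimension $2$ and let $\mathcal V$ be the partially ordered set of normalized proper valuations centered at $R$. Let $\tilde S$ be a totally ordered convex subset of $\mathcal V$. Then $\tilde S$ has a majorant in $\mathcal V$, that is, there exists $\tilde\mu\in\mathcal V$ such that $\tilde\nu\le\tilde\mu$ for all $\tilde\nu\in\tilde S$.
   Context: A valuation centered at $R$ is a function $\nu:R\to[0,\infty]=\mathbb R_{\ge0}\cup\{\infty\}$ such that $\nu(f+g)\ge\min(\nu(f),\nu(g))$ and $\nu(fg)=\nu(f)+\nu(g)$ for all $f,g\in R$, $\nu(0)=\infty$, $\nu(1)=0$, and $\nu(f)>0$ for all $f\in\mathfrak m$. Nonzero elements are allowed to have value $\infty$. The valuation is proper if $\nu$ is not identically $0$ on $R\setminus\{0\}$ and $\nu(\mathfrak m)\neq\{\infty\}$. It is normalized if $\inf\{\nu(f)\mid f\in\mathfrak m\}=1$. $\mathcal V$ denotes the set of normalized proper valuations centered at $R$ (each class of proper valuations modulo multiplication by positive real constants has exactly one normalized representative), partially ordered by: $\mu\le\nu$ if and only if $\mu(f)\le\nu(f)$ for all $f\in R$. A subset $S$ of a poset is convex if $\sigma\le\tau\le\sigma'$ with $\sigma,\sigma'\in S$ implies $\tau\in S$. *)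

theory Defs
  imports
    "HOL-Algebra.Algebra"
    "HOL-Library.Extended_Nat"
    "HOL-Library.Extended_Nonnegative_Real"
begin

section \<open>Regular local rings\<close>

text \<open>
  The Krull dimension counts the strict inclusions in a chain
  \<open>P 0 \<subset> \<dots> \<subset> P n\<close> of prime ideals. With this convention the zero ring, which has no prime
  ideals, gets dimension \<open>0\<close> instead of \<open>-\<infinity>\<close>; a local ring is never the zero ring.
\<close>

definition krull_dim :: "('a, 'b) ring_scheme \<Rightarrow> enat" where
  "krull_dim R = Sup {enat n | n. \<exists>P :: nat \<Rightarrow> 'a set.
     (\<forall>i\<le>n. primeideal (P i) R) \<and> (\<forall>i<n. P i \<subset> P (Suc i))}"

definition min_num_generators :: "('a, 'b) ring_scheme \<Rightarrow> 'a set \<Rightarrow> nat" where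
  "min_num_generators R I =
     (LEAST n. \<exists>A \<subseteq> carrier R. finite A \<and> card A = n \<and> I = Idl\<^bsub>R\<^esub> A)"

locale local_ring = cring R + maximalideal \<mm> R for R (structure) and \<mm> +
  assumes maximal_unique: "maximalideal M R \<Longrightarrow> M = \<mm>"

locale regular_local_ring = local_ring R \<mm> + noetherian_ring R for R (structure) and \<mm> +
  assumes regular: "enat (min_num_generators R \<mm>) = krull_dim R"


section \<open>Valuations centered at a local ring\<close>

text \<open>
  A valuation is a function on \<open>carrier R\<close>; its values outside the carrier are fixed by
  requiring it to be extensional, so that the pointwise order below is antisymmetric.
\<close>

definition centered_valuation ::
    "('a, 'b) ring_scheme \<Rightarrow> 'a set \<Rightarrow> ('a \<Rightarrow> ennreal) \<Rightarrow> bool" where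
  "centered_valuation R \<mm> \<nu> \<longleftrightarrow>
     \<nu> \<in> extensional (carrier R) \<and>
     (\<forall>f \<in> carrier R. \<forall>g \<in> carrier R. \<nu> (f \<oplus>\<^bsub>R\<^esub> g) \<ge> min (\<nu> f) (\<nu> g)) \<and>
     (\<forall>f \<in> carrier R. \<forall>g \<in> carrier R. \<nu> (f \<otimes>\<^bsub>R\<^esub> g) = \<nu> f + \<nu> g) \<and>
     \<nu> \<zero>\<^bsub>R\<^esub> = \<infinity> \<and>
     \<nu> \<one>\<^bsub>R\<^esub> = 0 \<and>
     (\<forall>f \<in> \<mm>. \<nu> f > 0)"

definition proper_valuation ::
    "('a, 'b) ring_scheme \<Rightarrow> 'a set \<Rightarrow> ('a \<Rightarrow> ennreal) \<Rightarrow> bool" where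
  "proper_valuation R \<mm> \<nu> \<longleftrightarrow>
     \<not> (\<forall>f \<in> carrier R - {\<zero>\<^bsub>R\<^esub>}. \<nu> f = 0) \<and> \<nu> ` \<mm> \<noteq> {\<infinity>}"

definition normalized_valuation :: "'a set \<Rightarrow> ('a \<Rightarrow> ennreal) \<Rightarrow> bool" where
  "normalized_valuation \<mm> \<nu> \<longleftrightarrow> Inf {\<nu> f | f. f \<in> \<mm>} = 1"

definition valuation_poset ::
    "('a, 'b) ring_scheme \<Rightarrow> 'a set \<Rightarrow> ('a \<Rightarrow> ennreal) gorder" where
  "valuation_poset R \<mm> =
     \<lparr>carrier = {\<nu>. centered_valuation R \<mm> \<nu> \<and> proper_valuation R \<mm> \<nu> \<and> normalized_valuation \<mm> \<nu>},
      eq = (=),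
      le = (\<lambda>\<mu> \<nu>. \<forall>f \<in> carrier R. \<mu> f \<le> \<nu> f)\<rparr>"

lemma partial_order_valuation_poset: "partial_order (valuation_poset R \<mm>)"
proof unfold_locales
  fix x y
  assume "x \<sqsubseteq>\<^bsub>valuation_poset R \<mm>\<^esub> y" "y \<sqsubseteq>\<^bsub>valuation_poset R \<mm>\<^esub> x"
    and "x \<in> carrier (valuation_poset R \<mm>)" "y \<in> carrier (valuation_poset R \<mm>)"
  then show "x .=\<^bsub>valuation_poset R \<mm>\<^esub> y"
    by (auto simp: valuation_poset_def centered_valuation_def
        intro: extensionalityI[where A = "carrier R"] order_antisym)
qed (auto simp: valuation_poset_def intro: order_trans)


section \<open>Convex and totally ordered subsets of a poset\<close>

definition order_convex :: "('c, 'd) gorder_scheme \<Rightarrow> 'c set \<Rightarrow> bool" where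
  "order_convex L S \<longleftrightarrow>
     (\<forall>\<sigma> \<in> S. \<forall>\<sigma>' \<in> S. \<forall>\<tau> \<in> carrier L. \<sigma> \<sqsubseteq>\<^bsub>L\<^esub> \<tau> \<and> \<tau> \<sqsubseteq>\<^bsub>L\<^esub> \<sigma>' \<longrightarrow> \<tau> \<in> S)"

definition totally_ordered_subset :: "('c, 'd) gorder_scheme \<Rightarrow> 'c set \<Rightarrow> bool" where
  "totally_ordered_subset L S \<longleftrightarrow> (\<forall>\<sigma> \<in> S. \<forall>\<tau> \<in> S. \<sigma> \<sqsubseteq>\<^bsub>L\<^esub> \<tau> \<or> \<tau> \<sqsubseteq>\<^bsub>L\<^esub> \<sigma>)"

end

theory Submission
  imports Defs
begin

text \<open>
  A nonempty chain of valuations has its pointwise supremum as a majorant: the infimum over the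
  maximal ideal is attained on a finite generating set, so a supremum that is greater than 1 on all
  generators would come from a single member of the chain with the same property.
  For the empty chain a normalized valuation must be exhibited. If \<open>x, y\<close> generate the maximal
  ideal, then no power of \<open>y\<close> lies in \<open>(x)\<close>, because otherwise the dimension would be at most 1;
  hence \<open>R/(x)\<close> is, up to elements of infinite value, a discrete valuation ring with uniformizer
  \<open>y\<close>, and its order function pulls back to \<open>R\<close>.
\<close>

section \<open>Noetherian local rings\<close>

text \<open>Zorn's lemma applies because in a Noetherian ring the union of a nonempty chain of
  ideals belongs to the chain.\<close>

lemma (in noetherian_ring) exists_maximal_element:
  assumes "F \<noteq> {}" and "\<And>I. I \<in> F \<Longrightarrow> ideal I R"
  shows "\<exists>M\<in>F. \<forall>I\<in>F. M \<subseteq> I \<longrightarrow> I = M"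
proof (rule subset_Zorn)
  fix C assume C: "subset.chain F C"
  show "\<exists>U\<in>F. \<forall>I\<in>C. I \<subseteq> U"
  proof (cases "C = {}")
    case True
    then show ?thesis using assms(1) by auto
  next
    case False
    have "subset.chain {I. ideal I R} C"
      using C assms(2) by (auto simp: pred_on.chain_def)
    from ideal_chain_is_trivial[OF False this] show ?thesis
      using C by (auto simp: pred_on.chain_def)
  qed
qed

lemma (in ring) PIdlE:
  assumes "f \<in> PIdl x"
  obtains a where "a \<in> carrier R" "f = a \<otimes> x"
  using assms unfolding cgenideal_def by blast

lemma (in ring) PIdlI: "a \<in> carrier R \<Longrightarrow> a \<otimes> x \<in> PIdl x"
  unfolding cgenideal_def by blast

lemma (in cring) mem_add_PIdl_iff:
  "f \<in> PIdl x <+>\<^bsub>R\<^esub> PIdl y \<longleftrightarrow> (\<exists>a\<in>carrier R. \<exists>b\<in>carrier R. f = a \<otimes> x \<oplus> b \<otimes> y)"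
  unfolding set_add_def' cgenideal_def by blast

lemma (in cring) Idl_pair:
  assumes "x \<in> carrier R" "y \<in> carrier R"
  shows "Idl {x, y} = PIdl x <+>\<^bsub>R\<^esub> PIdl y"
proof -
  have "Idl {x, y} = Idl (PIdl x \<union> PIdl y)"
  proof
    have *: "PIdl x \<union> PIdl y \<subseteq> carrier R"
      using assms cgenideal_ideal ideal.Icarr by fastforce
    show "Idl {x, y} \<subseteq> Idl (PIdl x \<union> PIdl y)"
      using assms cgenideal_self genideal_self[OF *]
      by (intro genideal_minimal genideal_ideal[OF *]) auto
    show "Idl (PIdl x \<union> PIdl y) \<subseteq> Idl {x, y}"
      using assms by (intro genideal_minimal genideal_ideal Un_least cgenideal_minimal)
        (auto intro: genideal_self[THEN subsetD])
  qed
  then show ?thesis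
    using assms union_genideal cgenideal_ideal by metis
qed

locale noetherian_local_ring = local_ring R \<mm> + noetherian_ring R for R (structure) and \<mm>

sublocale regular_local_ring \<subseteq> noetherian_local_ring ..

context noetherian_local_ring
begin

lemma one_notin_maximal: "\<one> \<notin> \<mm>"
  using one_imp_carrier I_notcarr by metis

text \<open>A maximal member among the proper ideals containing \<open>I\<close> is a maximal ideal
  of the ring, hence equal to \<open>\<mm>\<close> by uniqueness.\<close>

lemma ideal_subset_maximal:
  assumes "ideal I R" "\<one> \<notin> I"
  shows "I \<subseteq> \<mm>"
proof -
  let ?F = "{J. ideal J R \<and> \<one> \<notin> J \<and> I \<subseteq> J}"
  have "I \<in> ?F" using assms by simp
  then obtain M where M: "M \<in> ?F" and max: "\<And>J. J \<in> ?F \<Longrightarrow> M \<subseteq> J \<Longrightarrow> J = M"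
    using exists_maximal_element[of ?F] by (metis (no_types, lifting) empty_iff mem_Collect_eq)
  have "ideal M R" and "\<one> \<notin> M" and "I \<subseteq> M" using M by auto
  have "maximalideal M R"
  proof (rule maximalidealI)
    fix J assume J: "ideal J R" "M \<subseteq> J" "J \<subseteq> carrier R"
    show "J = M \<or> J = carrier R"
    proof (cases "\<one> \<in> J")
      case True
      then show ?thesis using ideal.one_imp_carrier[OF J(1)] by simp
    next
      case False
      then show ?thesis using max[of J] J \<open>I \<subseteq> M\<close> by auto
    qed
  qed (use \<open>ideal M R\<close> \<open>\<one> \<notin> M\<close> in auto)
  then show ?thesis using maximal_unique \<open>I \<subseteq> M\<close> by simp
qed

text \<open>The principal ideal of \<open>a\<close> is not inside \<open>\<mm>\<close>, so it must
  contain \<open>\<one>\<close>.\<close>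

lemma UnitsI_local:
  assumes "a \<in> carrier R" "a \<notin> \<mm>"
  shows "a \<in> Units R"
proof -
  have "\<one> \<in> PIdl a"
    using ideal_subset_maximal[OF cgenideal_ideal] cgenideal_self assms by blast
  then obtain b where "b \<in> carrier R" "\<one> = b \<otimes> a"
    unfolding cgenideal_def by auto
  then show ?thesis
    using assms(1) unfolding Units_def by (metis (mono_tags, lifting) m_comm mem_Collect_eq)
qed

lemma one_minus_Units:
  assumes "a \<in> \<mm>"
  shows "\<one> \<ominus> a \<in> Units R"
proof (rule UnitsI_local)
  show "\<one> \<ominus> a \<notin> \<mm>"
  proof
    assume "\<one> \<ominus> a \<in> \<mm>"
    then have "(\<one> \<ominus> a) \<oplus> a \<in> \<mm>" using assms by (rule a_closed)
    moreover have "(\<one> \<ominus> a) \<oplus> a = \<one>" using Icarr[OF assms] by algebra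
    ultimately show False using one_notin_maximal by simp
  qed
qed (use Icarr[OF assms] in simp)

lemma Units_mult_cancel_ideal:
  assumes "ideal I R" "u \<in> Units R" "a \<in> carrier R" "u \<otimes> a \<in> I"
  shows "a \<in> I"
proof -
  have "inv u \<otimes> (u \<otimes> a) \<in> I" using assms by (auto intro: ideal.I_l_closed)
  moreover have "inv u \<otimes> (u \<otimes> a) = a"
    using assms(2,3) by (metis Units_closed Units_inv_closed Units_l_inv l_one m_assoc)
  ultimately show ?thesis by simp
qed

text \<open>The assumption \<open>split\<close> says P = I + xP. If P were larger than I, take an
  ideal M maximal among those with I \<subseteq> M \<subset> P. Some xq with q in P lies outside M,
  so M + (xq) = P by maximality. Writing q = i + r(xq) with i in M gives (1 - rx)q \<in> M, and 1 -
  rx is a unit, so q and with it xq lie in M.\<close>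

lemma nakayama:
  assumes I: "ideal I R" and P: "ideal P R" and "I \<subseteq> P" and x: "x \<in> \<mm>"
    and split: "\<And>p. p \<in> P \<Longrightarrow> \<exists>i\<in>I. \<exists>q\<in>P. p = i \<oplus> x \<otimes> q"
  shows "P \<subseteq> I"
proof (rule ccontr)
  assume "\<not> P \<subseteq> I"
  let ?F = "{J. ideal J R \<and> I \<subseteq> J \<and> J \<subset> P}"
  have "I \<in> ?F" using I \<open>I \<subseteq> P\<close> \<open>\<not> P \<subseteq> I\<close> by auto
  then obtain M where MF: "M \<in> ?F" and max: "\<And>J. J \<in> ?F \<Longrightarrow> M \<subseteq> J \<Longrightarrow> J = M"
    using exists_maximal_element[of ?F] by (metis (no_types, lifting) empty_iff mem_Collect_eq)
  then have M: "ideal M R" "I \<subseteq> M" "M \<subset> P" by auto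
  interpret M: ideal M R by fact
  interpret P: ideal P R by fact
  have xc: "x \<in> carrier R" using Icarr x by simp
  \<comment> \<open>Otherwise P = I + xP would be contained in M.\<close>
  have "\<exists>q\<in>P. x \<otimes> q \<notin> M"
  proof (rule ccontr)
    assume "\<not> ?thesis"
    then have xM: "x \<otimes> q \<in> M" if "q \<in> P" for q using that by simp
    have "P \<subseteq> M"
    proof
      fix p assume "p \<in> P"
      then obtain i q where "i \<in> I" "q \<in> P" "p = i \<oplus> x \<otimes> q" using split by meson
      then show "p \<in> M" using M(2) xM M.a_closed by auto
    qed
    then show False using M(3) by simp
  qed
  then obtain q where q: "q \<in> P" "x \<otimes> q \<notin> M" by blast
  have qc: "q \<in> carrier R" using q P.Icarr by simp
  let ?J = "M <+>\<^bsub>R\<^esub> PIdl (x \<otimes> q)"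
  have pc: "x \<otimes> q \<in> carrier R" "x \<otimes> q \<in> P" using xc qc q P.I_l_closed by auto
  have pI: "x \<otimes> q \<in> PIdl (x \<otimes> q)" using cgenideal_self pc by simp
  have "ideal ?J R" using M cgenideal_ideal pc by (simp add: add_ideals)
  moreover have MJ: "M \<subseteq> ?J"
  proof
    fix a assume a: "a \<in> M"
    have "a = a \<oplus> \<zero> \<otimes> (x \<otimes> q)" using M.Icarr[OF a] pc by simp
    then show "a \<in> ?J" unfolding set_add_def' cgenideal_def using a by blast
  qed
  moreover have "?J \<subseteq> P"
    unfolding set_add_def' cgenideal_def using M pc by (auto intro!: P.a_closed P.I_l_closed)
  moreover have "x \<otimes> q \<in> ?J"
  proof -
    have "x \<otimes> q = \<zero> \<oplus> x \<otimes> q" using pc by simp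
    then show ?thesis unfolding set_add_def' using pI M.zero_closed by blast
  qed
  ultimately have "?J = P" using max[of ?J] M(2) q(2) by auto
  \<comment> \<open>The element \<open>q\<close> itself is decomposed in M + (xq), which makes it
    reappear on the right-hand side.\<close>
  then obtain i r where ir: "i \<in> M" "r \<in> carrier R" "q = i \<oplus> r \<otimes> (x \<otimes> q)"
    using q(1) unfolding set_add_def' cgenideal_def by blast
  have ic: "i \<in> carrier R" using ir M.Icarr by simp
  have "(\<one> \<ominus> r \<otimes> x) \<otimes> q = q \<ominus> r \<otimes> (x \<otimes> q)" using ir(2) xc qc by algebra
  also have "\<dots> = (i \<oplus> r \<otimes> (x \<otimes> q)) \<ominus> r \<otimes> (x \<otimes> q)" using ir(3) by simp
  also have "\<dots> = i" using ic ir(2) xc qc by algebra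
  finally have "(\<one> \<ominus> r \<otimes> x) \<otimes> q \<in> M" using ir by simp
  moreover have "\<one> \<ominus> r \<otimes> x \<in> Units R" using one_minus_Units ir x I_l_closed by simp
  ultimately have "q \<in> M" using Units_mult_cancel_ideal M(1) qc by blast
  then show False using q M.I_l_closed xc by blast
qed

end


lemma (in primeideal) mem_of_pow_mem:
  assumes "a \<in> carrier R" "a [^] (n::nat) \<in> I"
  shows "a \<in> I"
  using assms(2)
proof (induction n)
  case 0
  then show ?case using one_imp_carrier I_notcarr by simp
next
  case (Suc n)
  then show ?case using I_prime[of "a [^] n" a] assms(1) by auto
qed

section \<open>Maximal ideals with two generators\<close>

locale two_generated_local_ring = noetherian_local_ring +
  fixes x y
  assumes x_closed [simp]: "x \<in> carrier R" and y_closed [simp]: "y \<in> carrier R"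
    and maximal_eq: "\<mm> = Idl {x, y}"
begin

text \<open>This is the preimage of the n-th power of the maximal ideal of R/(x), which is generated
  by the image of \<open>y\<close>.\<close>

abbreviation J :: "nat \<Rightarrow> 'a set" where
  "J n \<equiv> PIdl x <+> PIdl (y [^] n)"

lemma J_iff: "f \<in> J n \<longleftrightarrow> (\<exists>a\<in>carrier R. \<exists>b\<in>carrier R. f = a \<otimes> x \<oplus> b \<otimes> y [^] n)"
  by (rule mem_add_PIdl_iff)

lemma J_I: "a \<in> carrier R \<Longrightarrow> b \<in> carrier R \<Longrightarrow> a \<otimes> x \<oplus> b \<otimes> y [^] n \<in> J n"
  unfolding J_iff by (intro bexI[of _ a] bexI[of _ b] refl)

lemma J_E:
  assumes "f \<in> J n"
  obtains a b where "a \<in> carrier R" "b \<in> carrier R" "f = a \<otimes> x \<oplus> b \<otimes> y [^] n"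
  using assms unfolding J_iff by (elim bexE)

lemma maximal_iff: "f \<in> \<mm> \<longleftrightarrow> (\<exists>a\<in>carrier R. \<exists>b\<in>carrier R. f = a \<otimes> x \<oplus> b \<otimes> y)"
  by (simp add: maximal_eq Idl_pair mem_add_PIdl_iff)

lemma gens_in_maximal: "x \<in> \<mm>" "y \<in> \<mm>"
  unfolding maximal_eq by (auto intro: genideal_self[THEN subsetD])

lemma ideal_J: "ideal (J n) R"
  by (simp add: add_ideals cgenideal_ideal)

lemma J_0: "J 0 = carrier R"
proof -
  have "f \<in> J 0" if "f \<in> carrier R" for f
    using J_I[of \<zero> f 0] that by simp
  then show ?thesis using ideal.Icarr[OF ideal_J] by (intro equalityI subsetI)
qed

lemma J_1: "J 1 = \<mm>"
  by (simp add: maximal_eq Idl_pair)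

lemma J_antimono:
  assumes "m \<le> n"
  shows "J n \<subseteq> J m"
proof
  fix f assume "f \<in> J n"
  then obtain a b where ab: "a \<in> carrier R" "b \<in> carrier R" "f = a \<otimes> x \<oplus> b \<otimes> y [^] n"
    by (rule J_E)
  have "y [^] n = y [^] (n - m) \<otimes> y [^] m" using assms by (simp add: nat_pow_mult)
  then have "f = a \<otimes> x \<oplus> (b \<otimes> y [^] (n - m)) \<otimes> y [^] m" using ab by (simp add: m_assoc)
  then show "f \<in> J m" using ab J_I by simp
qed

text \<open>Start from f = a x + b y^n. If \<open>b\<close> is a unit, the second form is reached;
  otherwise b = c x + d y, and substituting raises the exponent of \<open>y\<close> by one at the
  cost of a multiple of \<open>x\<close>.\<close>

lemma J_or_unit_form:
  assumes "f \<in> carrier R"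
  shows "f \<in> J n \<or> (\<exists>i<n. \<exists>u\<in>Units R. \<exists>a\<in>carrier R. f = a \<otimes> x \<oplus> u \<otimes> y [^] i)"
proof (induction n)
  case 0
  then show ?case using assms J_0 by simp
next
  case (Suc n)
  show ?case
  proof (cases "f \<in> J n")
    case True
    then obtain a b where ab: "a \<in> carrier R" "b \<in> carrier R" "f = a \<otimes> x \<oplus> b \<otimes> y [^] n"
      by (rule J_E)
    show ?thesis
    proof (cases "b \<in> \<mm>")
      case True
      then obtain c d where cd: "c \<in> carrier R" "d \<in> carrier R" "b = c \<otimes> x \<oplus> d \<otimes> y"
        unfolding maximal_iff by blast
      \<comment> \<open>The power of \<open>y\<close> is replaced by an arbitrary ring element
        \<open>Y\<close>, which leaves a polynomial identity; the same device recurs below.\<close>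
      have "a \<otimes> x \<oplus> (c \<otimes> x \<oplus> d \<otimes> y) \<otimes> Y = (a \<oplus> c \<otimes> Y) \<otimes> x \<oplus> d \<otimes> (Y \<otimes> y)" if "Y \<in> carrier R" for Y
        using ab(1) cd(1,2) that x_closed y_closed by algebra
      then have "f = (a \<oplus> c \<otimes> y [^] n) \<otimes> x \<oplus> d \<otimes> y [^] Suc n"
        using ab cd by simp
      moreover have "a \<oplus> c \<otimes> y [^] n \<in> carrier R" using ab cd by simp
      ultimately have "f \<in> J (Suc n)" using cd J_I by (simp only:)
      then show ?thesis ..
    next
      case False
      then show ?thesis using ab UnitsI_local by blast
    qed
  next
    case False
    then show ?thesis using Suc less_SucI by blast
  qed
qed

lemma J_or_unit_formE:
  assumes "f \<in> carrier R"
  obtains "f \<in> J n"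
    | i u a where "u \<in> Units R" "a \<in> carrier R" "f = a \<otimes> x \<oplus> u \<otimes> y [^] (i::nat)"
  using J_or_unit_form[OF assms, of n] by (elim disjE exE conjE bexE)

text \<open>Modulo \<open>x\<close> every element of \<open>\<mm>\<close> is a multiple of
  \<open>y\<close>, so its n-th power is a multiple of y^n.\<close>

lemma pow_in_J:
  assumes "z \<in> \<mm>"
  shows "z [^] n \<in> J n"
proof (induction n)
  case 0
  then show ?case using J_0 by simp
next
  case (Suc n)
  obtain c d where cd: "c \<in> carrier R" "d \<in> carrier R" "z = c \<otimes> x \<oplus> d \<otimes> y"
    using assms unfolding maximal_iff by blast
  obtain a b where ab: "a \<in> carrier R" "b \<in> carrier R" "z [^] n = a \<otimes> x \<oplus> b \<otimes> y [^] n"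
    using Suc by (rule J_E)
  have "(a \<otimes> x \<oplus> b \<otimes> Y) \<otimes> (c \<otimes> x \<oplus> d \<otimes> y) =
      (a \<otimes> (c \<otimes> x \<oplus> d \<otimes> y) \<oplus> b \<otimes> Y \<otimes> c) \<otimes> x \<oplus> (b \<otimes> d) \<otimes> (Y \<otimes> y)" if "Y \<in> carrier R" for Y
    using ab(1,2) cd(1,2) that x_closed y_closed by algebra
  from this[of "y [^] n"]
  have "z [^] Suc n = (a \<otimes> (c \<otimes> x \<oplus> d \<otimes> y) \<oplus> b \<otimes> y [^] n \<otimes> c) \<otimes> x \<oplus> (b \<otimes> d) \<otimes> y [^] Suc n"
    using ab(3) cd(3) by simp
  moreover have "a \<otimes> (c \<otimes> x \<oplus> d \<otimes> y) \<oplus> b \<otimes> y [^] n \<otimes> c \<in> carrier R" "b \<otimes> d \<in> carrier R"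
    using ab cd by auto
  ultimately show ?case using J_I by (simp only:)
qed

text \<open>
  Modulo \<open>x\<close>, the ideal \<open>P\<close> is generated by an element \<open>z\<close> of least order in \<open>y\<close>; Nakayama's lemma
  lifts this to \<open>P = (z)\<close>.
\<close>
lemma prime_principal:
  assumes P: "primeideal P R" and "x \<notin> P" and pow: "y [^] (n::nat) \<in> PIdl x"
  shows "\<exists>z\<in>P. P = PIdl z"
proof -
  interpret P: primeideal P R by fact
  obtain c where c: "c \<in> carrier R" "y [^] n = c \<otimes> x"
    using pow by (rule PIdlE)
  \<comment> \<open>Since y^n is a multiple of \<open>x\<close>, the ideal \<open>J n\<close>
    collapses to (x).\<close>
  have Jn: "\<exists>a\<in>carrier R. f = a \<otimes> x" if f: "f \<in> J n" for f
  proof -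
    obtain a b where ab: "a \<in> carrier R" "b \<in> carrier R" "f = a \<otimes> x \<oplus> b \<otimes> y [^] n"
      using f by (rule J_E)
    have "a \<otimes> x \<oplus> b \<otimes> (c \<otimes> x) = (a \<oplus> b \<otimes> c) \<otimes> x" using ab(1,2) c(1) x_closed by algebra
    then show ?thesis using ab c by auto
  qed
  have "\<exists>z\<in>P. \<forall>p\<in>P. \<exists>a\<in>carrier R. \<exists>b\<in>carrier R. p = a \<otimes> z \<oplus> x \<otimes> b"
  proof (cases "P \<subseteq> J n")
    case True
    \<comment> \<open>Here P is contained in (x), so modulo \<open>x\<close> it is generated by
      zero.\<close>
    show ?thesis
    proof (rule bexI[of _ \<zero>], rule ballI)
      fix p assume "p \<in> P"
      then obtain a where a: "a \<in> carrier R" "p = a \<otimes> x" using Jn True by blast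
      then have "p = \<zero> \<otimes> \<zero> \<oplus> x \<otimes> a" by (simp add: m_comm)
      then show "\<exists>a\<in>carrier R. \<exists>b\<in>carrier R. p = a \<otimes> \<zero> \<oplus> x \<otimes> b" using a by blast
    qed simp
  next
    case False
    let ?Q = "\<lambda>i::nat. \<exists>p\<in>P. \<exists>u\<in>Units R. \<exists>a\<in>carrier R. p = a \<otimes> x \<oplus> u \<otimes> y [^] i"
    define k where "k = (LEAST i. ?Q i)"
    obtain p where p: "p \<in> P" "p \<notin> J n" using False by (meson subsetI)
    from P.Icarr[OF p(1)] have "\<exists>i. ?Q i"
    proof (cases rule: J_or_unit_formE[where n = n])
      case 1
      then show ?thesis using p by simp
    next
      case (2 i u a)
      then show ?thesis using p(1) by metis
    qed
    then have "?Q k" unfolding k_def by (rule LeastI_ex)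
    then obtain z v d where z: "z \<in> P" "v \<in> Units R" "d \<in> carrier R" "z = d \<otimes> x \<oplus> v \<otimes> y [^] k"
      by (elim bexE)
    have zc: "z \<in> carrier R" using z(1) by (rule P.Icarr)
    show ?thesis
    proof (rule bexI[of _ z], rule ballI)
      fix p assume p: "p \<in> P"
      from P.Icarr[OF p] show "\<exists>a\<in>carrier R. \<exists>b\<in>carrier R. p = a \<otimes> z \<oplus> x \<otimes> b"
      proof (cases rule: J_or_unit_formE[where n = n])
        case 1
        then obtain a where a: "a \<in> carrier R" "p = a \<otimes> x" by (rule bexE[OF Jn])
        then have "p = \<zero> \<otimes> z \<oplus> x \<otimes> a" using zc by (simp add: m_comm)
        then show ?thesis using a by blast
      next
        case (2 i u a)
        then have "k \<le> i" unfolding k_def using p by (intro Least_le) metis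
        then have yi: "y [^] i = y [^] (i - k) \<otimes> y [^] k" by (simp add: nat_pow_mult)
        \<comment> \<open>Division of \<open>p\<close> by \<open>z\<close>: as k \<le> i by
          minimality, u w y^(i-k) is a quotient, and the remainder is a multiple of
          \<open>x\<close>.\<close>
        define w where "w = inv v"
        have w: "w \<in> carrier R" "v \<otimes> w = \<one>" "v \<in> carrier R" using z(2) unfolding w_def by auto
        have uc: "u \<in> carrier R" using 2 by auto
        have eq: "u \<otimes> w \<otimes> Z \<otimes> (d \<otimes> x \<oplus> v \<otimes> Y) \<oplus> x \<otimes> (a \<ominus> u \<otimes> w \<otimes> Z \<otimes> d)
            = a \<otimes> x \<oplus> u \<otimes> (v \<otimes> w) \<otimes> (Z \<otimes> Y)" if "Y \<in> carrier R" "Z \<in> carrier R" for Y Z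
          using w(1,3) uc 2(2) z(3) that x_closed by algebra
        have "p = u \<otimes> w \<otimes> y [^] (i - k) \<otimes> z \<oplus> x \<otimes> (a \<ominus> u \<otimes> w \<otimes> y [^] (i - k) \<otimes> d)"
          unfolding z(4) eq[OF nat_pow_closed[OF y_closed] nat_pow_closed[OF y_closed]] 2(3) yi w(2)
          using uc by simp
        then have "\<exists>b\<in>carrier R. p = u \<otimes> w \<otimes> y [^] (i - k) \<otimes> z \<oplus> x \<otimes> b"
          by (rule bexI) (use uc w(1) 2(2) z(3) in simp)
        then show ?thesis by (rule bexI) (use uc w(1) in simp)
      qed
    qed (use z in simp)
  qed
  then obtain z where z: "z \<in> P"
    and form: "\<And>p. p \<in> P \<Longrightarrow> \<exists>a\<in>carrier R. \<exists>b\<in>carrier R. p = a \<otimes> z \<oplus> x \<otimes> b" by blast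
  have zc: "z \<in> carrier R" using z by (rule P.Icarr)
  have sub: "PIdl z \<subseteq> P" by (rule cgenideal_minimal[OF P.is_ideal z])
  have "P \<subseteq> PIdl z"
  proof (rule nakayama[OF cgenideal_ideal[OF zc] P.is_ideal sub gens_in_maximal(1)])
    fix p assume p: "p \<in> P"
    then obtain a b where ab: "a \<in> carrier R" "b \<in> carrier R" "p = a \<otimes> z \<oplus> x \<otimes> b"
      using form by blast
    \<comment> \<open>The term x b = p - a z lies in the prime P while \<open>x\<close> does not, so
      \<open>b\<close> lies in P. This turns the decomposition modulo \<open>x\<close> into P = (z)
      + xP, as Nakayama's lemma requires.\<close>
    have "x \<otimes> b = (a \<otimes> z \<oplus> x \<otimes> b) \<ominus> a \<otimes> z" using ab(1,2) zc x_closed by algebra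
    then have "x \<otimes> b = p \<oplus> \<ominus> (a \<otimes> z)" using ab(3) by (simp add: minus_eq)
    then have "x \<otimes> b \<in> P" using P.a_closed[OF p P.a_inv_closed[OF P.I_l_closed[OF z ab(1)]]] by simp
    then have "b \<in> P" using P.I_prime[OF x_closed ab(2)] \<open>x \<notin> P\<close> by simp
    then show "\<exists>i\<in>PIdl z. \<exists>q\<in>P. p = i \<oplus> x \<otimes> q"
      using ab(3) by (intro bexI[of _ "a \<otimes> z"] bexI[of _ b]) (simp_all add: PIdlI ab)
  qed
  then show ?thesis using z sub by (intro bexI[of _ z]) (rule equalityI)
qed

text \<open>
  The instance of Krull's principal ideal theorem that is needed: if \<open>y [^] n\<close> were in \<open>(x)\<close>, then
  \<open>Q = (z)\<close> with \<open>z [^] n = a \<otimes> x\<close>, and dividing \<open>z [^] n \<ominus> a \<otimes> x \<in> P\<close> repeatedly by \<open>z \<notin> P\<close>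
  ends with a unit \<open>\<one> \<ominus> a' \<otimes> x\<close> in \<open>P\<close>.
\<close>
lemma pow_notin_PIdl:
  assumes P: "primeideal P R" and Q: "primeideal Q R" and "P \<subset> Q" "Q \<subset> \<mm>"
  shows "y [^] (n::nat) \<notin> PIdl x"
proof
  assume pow: "y [^] n \<in> PIdl x"
  interpret P: primeideal P R by fact
  interpret Q: primeideal Q R by fact
  \<comment> \<open>With \<open>x\<close> also y^n, and then \<open>y\<close>, would lie in Q,
    making Q all of \<open>\<mm>\<close>.\<close>
  have "x \<notin> Q"
  proof
    assume x: "x \<in> Q"
    then have "y [^] n \<in> Q" using subsetD[OF cgenideal_minimal[OF Q.is_ideal] pow] by simp
    then have "y \<in> Q" by (rule Q.mem_of_pow_mem[OF y_closed])
    then have "\<mm> \<subseteq> Q" unfolding maximal_eq using x by (intro genideal_minimal Q.is_ideal) auto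
    then show False using \<open>Q \<subset> \<mm>\<close> by blast
  qed
  then obtain z where z: "z \<in> Q" "Q = PIdl z" using prime_principal[OF Q _ pow] by blast
  have zc: "z \<in> carrier R" using z Q.Icarr by blast
  have "z \<notin> P" using cgenideal_minimal[OF P.is_ideal, of z] z \<open>P \<subset> Q\<close> by blast
  have descent: False if "a \<in> carrier R" "z [^] (j::nat) \<ominus> a \<otimes> x \<in> P" for a j
    using that
  proof (induction j arbitrary: a)
    case 0
    have "\<one> \<ominus> a \<otimes> x \<in> \<mm>" using 0 \<open>P \<subset> Q\<close> \<open>Q \<subset> \<mm>\<close> by auto
    moreover have "a \<otimes> x \<in> \<mm>" using I_l_closed gens_in_maximal 0 by blast
    ultimately have "(\<one> \<ominus> a \<otimes> x) \<oplus> a \<otimes> x \<in> \<mm>" by (rule a_closed)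
    moreover have "(\<one> \<ominus> a \<otimes> x) \<oplus> a \<otimes> x = \<one>" using 0(1) x_closed by algebra
    ultimately show ?case using one_notin_maximal by simp
  next
    case (Suc j)
    \<comment> \<open>Both z^(j+1) and the difference lie in Q, hence so does a x; as
      \<open>x \<notin> Q\<close>, this gives a = b z. A factor \<open>z\<close> then splits off the
      element of P and can be cancelled because \<open>z \<notin> P\<close>.\<close>
    have "z [^] Suc j \<in> Q" using Q.I_l_closed[OF z(1)] zc by simp
    moreover have "z [^] Suc j \<ominus> a \<otimes> x \<in> Q" using Suc \<open>P \<subset> Q\<close> by blast
    moreover have "a \<otimes> x = Z \<oplus> \<ominus> (Z \<ominus> a \<otimes> x)" if "Z \<in> carrier R" for Z
      using that Suc(2) x_closed by algebra
    ultimately have "a \<otimes> x \<in> Q"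
      by (metis Q.Icarr Q.a_closed Q.a_inv_closed)
    then have "a \<in> Q" using Q.I_prime[OF Suc(2) x_closed] \<open>x \<notin> Q\<close> by simp
    then obtain b where b: "b \<in> carrier R" "a = b \<otimes> z" unfolding z(2) by (rule PIdlE)
    have "Z \<otimes> z \<ominus> (b \<otimes> z) \<otimes> x = z \<otimes> (Z \<ominus> b \<otimes> x)" if "Z \<in> carrier R" for Z
      using that b(1) zc x_closed by algebra
    then have "z \<otimes> (z [^] j \<ominus> b \<otimes> x) \<in> P" using Suc(3) b zc by simp
    then have "z [^] j \<ominus> b \<otimes> x \<in> P" using P.I_prime[OF zc, of "z [^] j \<ominus> b \<otimes> x"] \<open>z \<notin> P\<close> zc b x_closed by simp
    then show ?case using Suc.IH b by blast
  qed
  \<comment> \<open>Start of the descent: z^n lies in (x, y^n), which equals (x), so z^n - a x is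
    zero for some \<open>a\<close>.\<close>
  have "z [^] n \<in> J n" using pow_in_J z \<open>Q \<subset> \<mm>\<close> by blast
  moreover have "J n \<subseteq> PIdl x"
  proof
    fix f assume "f \<in> J n"
    then obtain a b where ab: "a \<in> carrier R" "b \<in> carrier R" "f = a \<otimes> x \<oplus> b \<otimes> y [^] n"
      by (rule J_E)
    interpret X: ideal "PIdl x" R by (simp add: cgenideal_ideal)
    show "f \<in> PIdl x" using ab pow cgenideal_self[OF x_closed]
      by (simp add: X.a_closed X.I_l_closed)
  qed
  ultimately have "z [^] n \<in> PIdl x" by (rule subsetD[rotated])
  then obtain a where a: "a \<in> carrier R" "z [^] n = a \<otimes> x" by (rule PIdlE)
  then have "z [^] n \<ominus> a \<otimes> x = \<zero>" by (simp add: minus_eq r_neg)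
  then show False using descent a P.zero_closed by metis
qed

end

section \<open>Suprema of chains of valuations\<close>

lemma enat_le_if_nat_le:
  assumes "\<And>n. enat n \<le> a \<Longrightarrow> enat n \<le> b"
  shows "a \<le> b"
proof (cases b)
  case (enat m)
  then show ?thesis using assms[of "Suc m"] by (cases a) (force simp: not_less_eq_eq)+
qed simp

lemma enat_eq_infinityI:
  assumes "\<And>n. enat n \<le> a"
  shows "a = \<infinity>"
  using assms[of "Suc (the_enat a)"] by (cases a) auto

text \<open>This carries a lower bound for \<open>\<nu>\<close> from a set of generators over to the
  ideal they generate.\<close>

lemma valuation_level_ideal:
  assumes "cring R" and val: "centered_valuation R \<mm> \<nu>"
  shows "ideal {f \<in> carrier R. c \<le> \<nu> f} R"
proof -
  interpret cring R by fact
  have add: "min (\<nu> f) (\<nu> g) \<le> \<nu> (f \<oplus>\<^bsub>R\<^esub> g)" and mult: "\<nu> (f \<otimes>\<^bsub>R\<^esub> g) = \<nu> f + \<nu> g"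
    if "f \<in> carrier R" "g \<in> carrier R" for f g
    using val that unfolding centered_valuation_def by auto
  have zero: "\<nu> \<zero>\<^bsub>R\<^esub> = \<infinity>" using val unfolding centered_valuation_def by simp
  \<comment> \<open>All values are nonnegative, so multiplication cannot lower them. With the factor
    -1 this also yields closure under negation.\<close>
  have mult_ge: "c \<le> \<nu> (f \<otimes>\<^bsub>R\<^esub> g)" "c \<le> \<nu> (g \<otimes>\<^bsub>R\<^esub> f)"
    if "f \<in> carrier R" "g \<in> carrier R" "c \<le> \<nu> f" for f g
    using mult that by (auto simp: add_increasing2 add_increasing)
  show ?thesis
  proof (rule idealI)
    show "subgroup {f \<in> carrier R. c \<le> \<nu> f} (add_monoid R)"
    proof (rule add.subgroupI)
      show "{f \<in> carrier R. c \<le> \<nu> f} \<noteq> {}" using zero by (auto intro: exI[of _ "\<zero>\<^bsub>R\<^esub>"])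
      show "\<ominus>\<^bsub>R\<^esub> f \<in> {f \<in> carrier R. c \<le> \<nu> f}" if "f \<in> {f \<in> carrier R. c \<le> \<nu> f}" for f
        using that mult_ge(2)[of f "\<ominus>\<^bsub>R\<^esub> \<one>\<^bsub>R\<^esub>"] by (simp add: l_minus)
      show "f \<oplus>\<^bsub>R\<^esub> g \<in> {f \<in> carrier R. c \<le> \<nu> f}"
        if "f \<in> {f \<in> carrier R. c \<le> \<nu> f}" "g \<in> {f \<in> carrier R. c \<le> \<nu> f}" for f g
        using that add[of f g] by (auto intro: order_trans[of c "min (\<nu> f) (\<nu> g)"])
    qed auto
  qed (use mult_ge in \<open>auto intro: ring_axioms\<close>)
qed

lemma Sup_chain_in_valuation_poset:
  assumes cring: "cring R" and gen: "A \<subseteq> carrier R" "finite A" "\<mm> = Idl\<^bsub>R\<^esub> A"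
    and S: "S \<subseteq> carrier (valuation_poset R \<mm>)" "S \<noteq> {}"
    and total: "totally_ordered_subset (valuation_poset R \<mm>) S"
  shows "restrict (\<lambda>f. SUP \<nu>\<in>S. \<nu> f) (carrier R) \<in> carrier (valuation_poset R \<mm>)"
proof -
  interpret cring R by fact
  define \<mu> where "\<mu> = restrict (\<lambda>f. SUP \<nu>\<in>S. \<nu> f) (carrier R)"
  have \<mu>: "\<mu> f = (SUP \<nu>\<in>S. \<nu> f)" if "f \<in> carrier R" for f
    using that by (simp add: \<mu>_def)
  have max_sub: "\<mm> \<subseteq> carrier R" using ideal.Icarr[OF genideal_ideal[OF gen(1)]] gen(3) by auto
  have val: "centered_valuation R \<mm> \<nu>" and proper: "proper_valuation R \<mm> \<nu>"
    and norm: "normalized_valuation \<mm> \<nu>" if "\<nu> \<in> S" for \<nu>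
    using S that by (auto simp: valuation_poset_def)
  have upper: "\<nu> f \<le> \<mu> f" if "\<nu> \<in> S" "f \<in> carrier R" for \<nu> f
    using that by (auto simp: \<mu> intro: SUP_upper)
  \<comment> \<open>Lower bounds obtained at \<open>f\<close> and at \<open>g\<close> from different
    members hold together for a single one. Both the minimum inequality and additivity of the
    supremum rest on this.\<close>
  have chain: "\<exists>\<rho>\<in>S. \<forall>f\<in>carrier R. \<sigma> f \<le> \<rho> f \<and> \<tau> f \<le> \<rho> f" if "\<sigma> \<in> S" "\<tau> \<in> S" for \<sigma> \<tau>
  proof -
    have "(\<forall>f\<in>carrier R. \<sigma> f \<le> \<tau> f) \<or> (\<forall>f\<in>carrier R. \<tau> f \<le> \<sigma> f)"
      using total that unfolding totally_ordered_subset_def valuation_poset_def by simp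
    then show ?thesis using that by (metis order_refl)
  qed
  obtain \<nu>0 where \<nu>0: "\<nu>0 \<in> S" using S by blast

  have "centered_valuation R \<mm> \<mu>"
    unfolding centered_valuation_def
  proof (intro conjI ballI)
    show "\<mu> \<in> extensional (carrier R)" by (simp add: \<mu>_def)
  next
    fix f g assume fg: "f \<in> carrier R" "g \<in> carrier R"
    show "min (\<mu> f) (\<mu> g) \<le> \<mu> (f \<oplus>\<^bsub>R\<^esub> g)"
    proof (rule ccontr)
      assume "\<not> ?thesis"
      then have "\<mu> (f \<oplus>\<^bsub>R\<^esub> g) < \<mu> f" "\<mu> (f \<oplus>\<^bsub>R\<^esub> g) < \<mu> g" by (simp_all add: not_le min_le_iff_disj)
      then obtain \<sigma> \<tau> where st: "\<sigma> \<in> S" "\<tau> \<in> S" "\<mu> (f \<oplus>\<^bsub>R\<^esub> g) < \<sigma> f" "\<mu> (f \<oplus>\<^bsub>R\<^esub> g) < \<tau> g"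
        using fg by (auto simp: \<mu>[of f] \<mu>[of g] less_SUP_iff)
      obtain \<rho> where \<rho>: "\<rho> \<in> S" "\<sigma> f \<le> \<rho> f" "\<tau> g \<le> \<rho> g" using chain[OF st(1,2)] fg by auto
      have "min (\<rho> f) (\<rho> g) \<le> \<rho> (f \<oplus>\<^bsub>R\<^esub> g)"
        using val[OF \<rho>(1)] fg unfolding centered_valuation_def by auto
      also have "\<dots> \<le> \<mu> (f \<oplus>\<^bsub>R\<^esub> g)" using upper \<rho>(1) fg by simp
      finally show False using st \<rho> by (auto simp: min_le_iff_disj)
    qed
    have "\<mu> (f \<otimes>\<^bsub>R\<^esub> g) = (SUP \<nu>\<in>S. \<nu> f + \<nu> g)"
      unfolding \<mu>[OF m_closed[OF fg]]
      by (intro SUP_cong refl) (use val fg in \<open>auto simp: centered_valuation_def\<close>)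
    also have "\<dots> = \<mu> f + \<mu> g"
      unfolding \<mu>[OF fg(1)] \<mu>[OF fg(2)]
    proof (rule SUP_add_directed_ennreal)
      fix \<sigma> \<tau> assume "\<sigma> \<in> S" "\<tau> \<in> S"
      then obtain \<rho> where \<rho>: "\<rho> \<in> S" "\<sigma> f \<le> \<rho> f" "\<tau> g \<le> \<rho> g" using chain[of \<sigma> \<tau>] fg by auto
      then show "\<exists>\<rho>\<in>S. \<sigma> f + \<tau> g \<le> \<rho> f + \<rho> g" by (auto intro: add_mono)
    qed
    finally show "\<mu> (f \<otimes>\<^bsub>R\<^esub> g) = \<mu> f + \<mu> g" .
  next
    show "\<mu> \<zero>\<^bsub>R\<^esub> = \<infinity>"
      using upper[OF \<nu>0, of "\<zero>\<^bsub>R\<^esub>"] val[OF \<nu>0] by (simp add: centered_valuation_def top_unique)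
    have "\<mu> \<one>\<^bsub>R\<^esub> = (SUP \<nu>\<in>S. 0)"
      unfolding \<mu>[OF one_closed]
      by (intro SUP_cong refl) (use val in \<open>auto simp: centered_valuation_def\<close>)
    then show "\<mu> \<one>\<^bsub>R\<^esub> = 0" using S(2) by simp
  next
    fix f assume "f \<in> \<mm>"
    then have "0 < \<nu>0 f" "f \<in> carrier R"
      using val[OF \<nu>0] max_sub by (auto simp: centered_valuation_def)
    then show "0 < \<mu> f" using upper[OF \<nu>0, of f] by (auto intro: less_le_trans)
  qed
  moreover have Inf_mu: "Inf {\<mu> f |f. f \<in> \<mm>} = 1"
  proof (rule antisym)
    show "1 \<le> Inf {\<mu> f |f. f \<in> \<mm>}"
    proof (rule Inf_greatest, clarify)
      fix f assume f: "f \<in> \<mm>"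
      have "1 \<le> \<nu>0 f"
        using norm[OF \<nu>0] f unfolding normalized_valuation_def by (metis (mono_tags, lifting) Inf_lower mem_Collect_eq)
      also have "\<dots> \<le> \<mu> f" using upper[OF \<nu>0] f max_sub by auto
      finally show "1 \<le> \<mu> f" .
    qed
    show "Inf {\<mu> f |f. f \<in> \<mm>} \<le> 1"
    proof (rule ccontr)
      assume "\<not> ?thesis"
      then have gt: "1 < Inf {\<mu> f |f. f \<in> \<mm>}" by simp
      have A_gt: "1 < \<mu> a" if "a \<in> A" for a
      proof -
        have "a \<in> \<mm>" using that genideal_self[OF gen(1)] gen(3) by blast
        then have "Inf {\<mu> f |f. f \<in> \<mm>} \<le> \<mu> a" by (intro Inf_lower) auto
        with gt show ?thesis by simp
      qed
      \<comment> \<open>Induction over finite sets of generators merges the separate witnesses into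
        one member of the chain.\<close>
      have "\<exists>\<nu>\<in>S. \<forall>a\<in>B. 1 < \<nu> a" if "B \<subseteq> A" for B
        using finite_subset[OF that gen(2)] that
      proof induction
        case empty
        then show ?case using \<nu>0 by auto
      next
        case (insert b B)
        then obtain \<sigma> where \<sigma>: "\<sigma> \<in> S" "\<forall>a\<in>B. 1 < \<sigma> a" by auto
        have "b \<in> carrier R" using insert gen(1) by auto
        then obtain \<tau> where \<tau>: "\<tau> \<in> S" "1 < \<tau> b"
          using A_gt[of b] insert by (auto simp: \<mu> less_SUP_iff)
        obtain \<rho> where \<rho>: "\<rho> \<in> S" "\<forall>f\<in>carrier R. \<sigma> f \<le> \<rho> f \<and> \<tau> f \<le> \<rho> f"
          using chain \<sigma> \<tau> by blast
        have "1 < \<rho> a" if a: "a \<in> insert b B" for a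
        proof -
          have "a \<in> carrier R" using a insert.prems gen(1) by auto
          then have "\<sigma> a \<le> \<rho> a" "\<tau> a \<le> \<rho> a" using \<rho>(2) by auto
          then show ?thesis using \<sigma>(2) \<tau>(2) a by (auto intro: less_le_trans)
        qed
        then show ?case using \<rho>(1) by (intro bexI[of _ \<rho>] ballI)
      qed
      then obtain \<nu> where \<nu>: "\<nu> \<in> S" "\<forall>a\<in>A. 1 < \<nu> a" by blast
      \<comment> \<open>An infimum over a finite set is attained, so it stays strictly above 1; for
        empty \<open>A\<close> it is infinite.\<close>
      define c where "c = Inf (\<nu> ` A)"
      have "1 < c" unfolding c_def using \<nu> gen(2)
        by (cases "A = {}") (auto simp: cInf_eq_Min)
      \<comment> \<open>The level ideal of \<open>c\<close> contains the generators, hence all of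
        \<open>\<mm>\<close>, and \<open>\<nu>\<close> would have infimum at least c > 1.\<close>
      have "Idl\<^bsub>R\<^esub> A \<subseteq> {f \<in> carrier R. c \<le> \<nu> f}"
        using gen(1) by (intro genideal_minimal valuation_level_ideal[OF cring val[OF \<nu>(1)]])
          (auto simp: c_def intro: Inf_lower)
      then have "c \<le> Inf {\<nu> f |f. f \<in> \<mm>}" using gen(3) by (intro Inf_greatest) auto
      then show False using norm[OF \<nu>(1)] \<open>1 < c\<close> by (simp add: normalized_valuation_def)
    qed
  qed
  moreover have "proper_valuation R \<mm> \<mu>"
  proof -
    obtain f where "f \<in> carrier R - {\<zero>\<^bsub>R\<^esub>}" "\<nu>0 f \<noteq> 0"
      using proper[OF \<nu>0] unfolding proper_valuation_def by auto
    then have "\<not> (\<forall>f\<in>carrier R - {\<zero>\<^bsub>R\<^esub>}. \<mu> f = 0)"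
      using upper[OF \<nu>0, of f] by (intro notI) auto
    moreover have "\<mu> ` \<mm> \<noteq> {\<infinity>}"
    proof
      assume "\<mu> ` \<mm> = {\<infinity>}"
      then have "{\<mu> f |f. f \<in> \<mm>} = {\<infinity>}" by (simp add: Setcompr_eq_image)
      then show False using Inf_mu by simp
    qed
    ultimately show ?thesis by (simp add: proper_valuation_def)
  qed
  ultimately show ?thesis
    unfolding \<mu>_def[symmetric] by (simp add: valuation_poset_def normalized_valuation_def)
qed

section \<open>The order of vanishing along a regular parameter\<close>

context two_generated_local_ring
begin

text \<open>For \<open>f\<close> in the ring this is the order of its image in R/(x) with respect to
  powers of the maximal ideal; it is infinite on the intersection of all \<open>J n\<close>.\<close>

definition adic_order :: "'a \<Rightarrow> enat" where
  "adic_order f = Sup {enat n | n. f \<in> J n}"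

text \<open>Because the ideals \<open>J n\<close> decrease, an element outside \<open>J n\<close>
  can lie in \<open>J k\<close> for k < n at most, which bounds the supremum by n - 1.\<close>

lemma le_adic_order_iff:
  assumes "f \<in> carrier R"
  shows "enat n \<le> adic_order f \<longleftrightarrow> f \<in> J n"
proof
  show "f \<in> J n \<Longrightarrow> enat n \<le> adic_order f"
    unfolding adic_order_def by (rule Sup_upper) auto
  show "enat n \<le> adic_order f \<Longrightarrow> f \<in> J n"
  proof (rule ccontr)
    assume le: "enat n \<le> adic_order f" and nmem: "f \<notin> J n"
    \<comment> \<open>\<open>J 0\<close> is the whole ring, so n - 1 is a true predecessor.\<close>
    then have "0 < n" using assms J_0 by (cases n) auto
    have "adic_order f \<le> enat (n - 1)"
      unfolding adic_order_def
    proof (rule Sup_least, clarify)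
      fix k assume "f \<in> J k"
      then have "\<not> n \<le> k" using J_antimono[of n k] nmem by auto
      then show "enat k \<le> enat (n - 1)" by simp
    qed
    then have "enat n \<le> enat (n - 1)" using le by (rule order_trans[rotated])
    then show False using \<open>0 < n\<close> by simp
  qed
qed

lemma adic_order_zero: "adic_order \<zero> = \<infinity>"
proof -
  have "\<zero> \<in> J n" for n
    using ideal_J additive_subgroup.zero_closed ideal.axioms(1) by blast
  then show ?thesis
    by (intro enat_eq_infinityI) (simp add: le_adic_order_iff)
qed

lemma adic_order_add:
  assumes "f \<in> carrier R" "g \<in> carrier R"
  shows "min (adic_order f) (adic_order g) \<le> adic_order (f \<oplus> g)"
proof (rule enat_le_if_nat_le)
  fix n assume "enat n \<le> min (adic_order f) (adic_order g)"
  then have "f \<in> J n" "g \<in> J n" using assms by (simp_all add: le_adic_order_iff)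
  then have "f \<oplus> g \<in> J n"
    using additive_subgroup.a_closed[OF ideal.axioms(1)[OF ideal_J]] by simp
  then show "enat n \<le> adic_order (f \<oplus> g)" using assms by (simp add: le_adic_order_iff)
qed

end

text \<open>The condition says that \<open>y\<close> is not nilpotent modulo \<open>x\<close>. It is
  the form in which dimension 2 enters, supplied by \<open>pow_notin_PIdl\<close>.\<close>

locale two_generated_local_ring_dim2 = two_generated_local_ring +
  assumes pow_notin: "\<And>n::nat. y [^] n \<notin> PIdl x"
begin

text \<open>Comparing the two expressions puts (u - c y) y^i into (x). Since c y lies in
  \<open>\<mm>\<close>, the factor u - c y is a unit, so y^i would lie in (x).\<close>

lemma unit_form_notin_J:
  assumes "a \<in> carrier R" "u \<in> Units R"
  shows "a \<otimes> x \<oplus> u \<otimes> y [^] i \<notin> J (Suc i)"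
proof
  assume "a \<otimes> x \<oplus> u \<otimes> y [^] i \<in> J (Suc i)"
  then obtain b c where bc: "b \<in> carrier R" "c \<in> carrier R"
    and eq: "a \<otimes> x \<oplus> u \<otimes> y [^] i = b \<otimes> x \<oplus> c \<otimes> y [^] Suc i"
    by (rule J_E)
  have uc: "u \<in> carrier R" using assms(2) by (rule Units_closed)
  have "u \<ominus> c \<otimes> y \<notin> \<mm>"
  proof
    assume "u \<ominus> c \<otimes> y \<in> \<mm>"
    then have "(u \<ominus> c \<otimes> y) \<oplus> c \<otimes> y \<in> \<mm>"
      using I_l_closed[OF gens_in_maximal(2) bc(2)] by (rule a_closed)
    moreover have "(u \<ominus> c \<otimes> y) \<oplus> c \<otimes> y = u" using uc bc(2) y_closed by algebra
    ultimately have "u \<in> \<mm>" by simp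
    then have "u \<otimes> inv u \<in> \<mm>" by (rule I_r_closed) (use assms(2) in simp)
    then show False using assms(2) one_notin_maximal by simp
  qed
  then have unit: "u \<ominus> c \<otimes> y \<in> Units R" using UnitsI_local uc bc by simp
  have "(u \<ominus> c \<otimes> y) \<otimes> Y = (b \<ominus> a) \<otimes> x"
    if "Y \<in> carrier R" "a \<otimes> x \<oplus> u \<otimes> Y = b \<otimes> x \<oplus> c \<otimes> (Y \<otimes> y)" for Y
  proof -
    have "(u \<ominus> c \<otimes> y) \<otimes> Y = (a \<otimes> x \<oplus> u \<otimes> Y) \<ominus> a \<otimes> x \<ominus> c \<otimes> (Y \<otimes> y)"
      using assms(1) uc bc that(1) x_closed y_closed by algebra
    also have "\<dots> = (b \<otimes> x \<oplus> c \<otimes> (Y \<otimes> y)) \<ominus> a \<otimes> x \<ominus> c \<otimes> (Y \<otimes> y)"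
      using that(2) by simp
    also have "\<dots> = (b \<ominus> a) \<otimes> x"
      using assms(1) bc that(1) x_closed y_closed by algebra
    finally show ?thesis .
  qed
  from this[of "y [^] i"] eq have "(u \<ominus> c \<otimes> y) \<otimes> y [^] i = (b \<ominus> a) \<otimes> x" by simp
  then have "(u \<ominus> c \<otimes> y) \<otimes> y [^] i \<in> PIdl x" using PIdlI[of "b \<ominus> a" x] bc assms(1) by simp
  then have "y [^] i \<in> PIdl x"
    by (rule Units_mult_cancel_ideal[OF cgenideal_ideal[OF x_closed] unit nat_pow_closed[OF y_closed]])
  then show False using pow_notin[of i] by simp
qed

lemma adic_order_unit_form:
  assumes "a \<in> carrier R" "u \<in> Units R"
  shows "adic_order (a \<otimes> x \<oplus> u \<otimes> y [^] i) = enat i"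
proof -
  let ?f = "a \<otimes> x \<oplus> u \<otimes> y [^] i"
  have uc: "u \<in> carrier R" using assms(2) by (rule Units_closed)
  have fc: "?f \<in> carrier R" using assms uc by simp
  have "enat i \<le> adic_order ?f" using J_I[OF assms(1) uc] le_adic_order_iff[OF fc] by simp
  moreover have "\<not> enat (Suc i) \<le> adic_order ?f"
    using unit_form_notin_J[OF assms] le_adic_order_iff[OF fc] by simp
  ultimately show ?thesis by (cases "adic_order ?f") auto
qed

lemma adic_order_cases:
  assumes "f \<in> carrier R"
  obtains "adic_order f = \<infinity>"
    | i u a where "u \<in> Units R" "a \<in> carrier R" "f = a \<otimes> x \<oplus> u \<otimes> y [^] (i::nat)"
proof (cases "adic_order f")
  case (enat n)
  from assms show ?thesis
  \<comment> \<open>The exponent is one above the order, so membership in the ideal is excluded and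
    the unit form remains.\<close>
  proof (cases rule: J_or_unit_formE[where n = "Suc n"])
    case 1
    then have "enat (Suc n) \<le> adic_order f" using le_adic_order_iff[OF assms] by simp
    then show ?thesis using enat by simp
  qed (rule that(2))
qed (rule that(1))

lemma adic_order_mult_infinity:
  assumes "f \<in> carrier R" "g \<in> carrier R" "adic_order f = \<infinity>"
  shows "adic_order (f \<otimes> g) = \<infinity>"
proof (rule enat_eq_infinityI)
  fix n
  have "f \<in> J n" using le_adic_order_iff[OF assms(1), of n] assms(3) by simp
  then have "f \<otimes> g \<in> J n" using ideal.I_r_closed[OF ideal_J] assms(2) by simp
  then show "enat n \<le> adic_order (f \<otimes> g)" using le_adic_order_iff[of "f \<otimes> g"] assms by simp
qed

text \<open>For two unit forms the product of the leading units is a unit and all other terms are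
  multiples of \<open>x\<close>, so the exponents add. An infinite order persists because each
  \<open>J n\<close> is an ideal.\<close>

lemma adic_order_mult:
  assumes "f \<in> carrier R" "g \<in> carrier R"
  shows "adic_order (f \<otimes> g) = adic_order f + adic_order g"
  using assms(1)
proof (cases rule: adic_order_cases)
  case 1
  then show ?thesis using adic_order_mult_infinity assms by simp
next
  case f: (2 i u a)
  from assms(2) show ?thesis
  proof (cases rule: adic_order_cases)
    case 1
    then show ?thesis using adic_order_mult_infinity[of g f] assms by (simp add: m_comm)
  next
    case g: (2 j v b)
    have uv: "u \<in> carrier R" "v \<in> carrier R" using f(1) g(1) by (simp_all add: Units_closed)
    have "(a \<otimes> x \<oplus> u \<otimes> Y) \<otimes> (b \<otimes> x \<oplus> v \<otimes> Z) =
        (a \<otimes> (b \<otimes> x \<oplus> v \<otimes> Z) \<oplus> u \<otimes> Y \<otimes> b) \<otimes> x \<oplus> (u \<otimes> v) \<otimes> (Y \<otimes> Z)"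
      if "Y \<in> carrier R" "Z \<in> carrier R" for Y Z
      using that uv f(2) g(2) x_closed by algebra
    from this[of "y [^] i" "y [^] j"]
    have "f \<otimes> g = (a \<otimes> (b \<otimes> x \<oplus> v \<otimes> y [^] j) \<oplus> u \<otimes> y [^] i \<otimes> b) \<otimes> x \<oplus> (u \<otimes> v) \<otimes> y [^] (i + j)"
      using f(3) g(3) by (simp add: nat_pow_mult)
    also have "adic_order \<dots> = enat (i + j)"
      using f(1,2) g(1,2) uv by (intro adic_order_unit_form) auto
    finally show ?thesis
      using adic_order_unit_form[OF f(2,1), of i] adic_order_unit_form[OF g(2,1), of j] f(3) g(3)
      by simp
  qed
qed

definition adic_valuation :: "'a \<Rightarrow> ennreal" where
  "adic_valuation = restrict (\<lambda>f. ennreal_of_enat (adic_order f)) (carrier R)"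

lemma adic_order_one: "adic_order \<one> = 0"
  using adic_order_unit_form[of \<zero> \<one> 0] by (simp add: zero_enat_def)

lemma adic_order_y: "adic_order y = 1"
  using adic_order_unit_form[of \<zero> \<one> 1] by (simp add: one_enat_def)

lemma adic_order_maximal:
  assumes "f \<in> \<mm>"
  shows "1 \<le> adic_order f"
  using assms Icarr[OF assms] J_1 le_adic_order_iff[of f 1] by (simp add: one_enat_def)

text \<open>Normalization holds because \<open>y\<close> has value 1 and every element of
  \<open>\<mm>\<close> = \<open>J 1\<close> has order at least 1.\<close>

lemma adic_valuation_in_poset: "adic_valuation \<in> carrier (valuation_poset R \<mm>)"
proof -
  have val: "adic_valuation f = ennreal_of_enat (adic_order f)" if "f \<in> carrier R" for f
    using that by (simp add: adic_valuation_def)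
  have val_y: "adic_valuation y = 1" by (simp add: val adic_order_y)
  have val_max: "1 \<le> adic_valuation f" if "f \<in> \<mm>" for f
  proof -
    have "ennreal_of_enat 1 \<le> ennreal_of_enat (adic_order f)"
      using adic_order_maximal[OF that] by (simp only: ennreal_of_enat_le_iff)
    then show ?thesis using val[OF Icarr[OF that]] by simp
  qed
  have "centered_valuation R \<mm> adic_valuation"
    unfolding centered_valuation_def
  proof (intro conjI ballI)
    fix f g assume fg: "f \<in> carrier R" "g \<in> carrier R"
    show "min (adic_valuation f) (adic_valuation g) \<le> adic_valuation (f \<oplus> g)"
      using adic_order_add[OF fg] fg by (simp add: val min_le_iff_disj)
    show "adic_valuation (f \<otimes> g) = adic_valuation f + adic_valuation g"
      using adic_order_mult[OF fg] fg by (simp add: val)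
  next
    fix f assume "f \<in> \<mm>"
    then show "0 < adic_valuation f" using val_max[of f] by (auto intro: less_le_trans[of 0 1])
  qed (simp_all add: val adic_order_zero adic_order_one, simp add: adic_valuation_def)
  moreover have "proper_valuation R \<mm> adic_valuation"
    unfolding proper_valuation_def
  proof
    have "y \<noteq> \<zero>" using adic_order_y adic_order_zero by auto
    then show "\<not> (\<forall>f\<in>carrier R - {\<zero>}. adic_valuation f = 0)"
      using val_y by (intro notI) (auto dest: bspec[of _ _ y])
    show "adic_valuation ` \<mm> \<noteq> {\<infinity>}"
    proof
      assume "adic_valuation ` \<mm> = {\<infinity>}"
      then have "adic_valuation y = \<infinity>" using gens_in_maximal(2) by auto
      then show False using val_y by simp
    qed
  qed
  moreover have "Inf {adic_valuation f |f. f \<in> \<mm>} = 1"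
  proof (rule antisym)
    show "Inf {adic_valuation f |f. f \<in> \<mm>} \<le> 1"
      using gens_in_maximal(2) val_y by (intro Inf_lower) (auto intro!: exI[of _ y])
    show "1 \<le> Inf {adic_valuation f |f. f \<in> \<mm>}"
      using val_max by (intro Inf_greatest) auto
  qed
  ultimately show ?thesis by (simp add: valuation_poset_def normalized_valuation_def)
qed

end

section \<open>Regular parameters, chains of primes and existence of a normalized valuation\<close>

lemma (in regular_local_ring) maximal_two_generated:
  assumes "krull_dim R = 2"
  obtains x y where "x \<in> carrier R" "y \<in> carrier R" "\<mm> = Idl {x, y}"
proof -
  let ?P = "\<lambda>n. \<exists>A\<subseteq>carrier R. finite A \<and> card A = n \<and> \<mm> = Idl A"
  have "enat (min_num_generators R \<mm>) = enat 2"
    using regular assms by (simp add: numeral_eq_enat)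
  then have "(LEAST n. ?P n) = 2" unfolding min_num_generators_def by simp
  \<comment> \<open>Finite generation guarantees that the \<open>LEAST\<close> is attained by an
    actual generating set.\<close>
  moreover have "\<exists>n. ?P n" using finetely_gen[OF is_ideal] by auto
  ultimately have "?P 2" using LeastI_ex[of ?P] by simp
  then obtain A where A: "A \<subseteq> carrier R" "card A = 2" "\<mm> = Idl A" by auto
  then obtain x y where "A = {x, y}" by (meson card_2_iff)
  then show thesis using A that by auto
qed

text \<open>A chain longer than \<open>Suc n\<close> can be truncated, so if none of length
  \<open>Suc n\<close> existed, all lengths would be at most \<open>n\<close> and so would their
  supremum.\<close>

lemma prime_chain_of_krull_dim:
  assumes "krull_dim R = enat (Suc n)"
  shows "\<exists>P :: nat \<Rightarrow> _. (\<forall>i\<le>Suc n. primeideal (P i) R) \<and> (\<forall>i<Suc n. P i \<subset> P (Suc i))"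
proof (rule ccontr)
  let ?Q = "\<lambda>k P. (\<forall>i\<le>k. primeideal (P i) R) \<and> (\<forall>i<k. P i \<subset> P (Suc i))"
  assume none: "\<not> ?thesis"
  have "krull_dim R \<le> enat n"
    unfolding krull_dim_def
  proof (rule Sup_least, clarify)
    fix k P assume P: "\<forall>i\<le>k. primeideal (P i) R" "\<forall>i<k. P i \<subset> P (Suc i)"
    show "enat k \<le> enat n"
    proof (rule ccontr)
      assume "\<not> enat k \<le> enat n"
      then have "Suc n \<le> k" by simp
      then have "?Q (Suc n) P" using P by auto
      then show False using none by blast
    qed
  qed
  then show False using assms by simp
qed

lemma (in regular_local_ring) valuation_poset_nonempty:
  assumes dim: "krull_dim R = 2"
  shows "carrier (valuation_poset R \<mm>) \<noteq> {}"
proof -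
  obtain x y where xy: "x \<in> carrier R" "y \<in> carrier R" "\<mm> = Idl {x, y}"
    using maximal_two_generated[OF dim] .
  interpret two_generated_local_ring R \<mm> x y
    by unfold_locales (use xy in auto)
  have "krull_dim R = enat (Suc 1)" using dim by (simp add: numeral_eq_enat)
  then obtain P where P: "\<And>i. i \<le> 2 \<Longrightarrow> primeideal (P i) R" "\<And>i. i < 2 \<Longrightarrow> P i \<subset> P (Suc i)"
    using prime_chain_of_krull_dim[of R 1] by (auto simp: numeral_2_eq_2)
  \<comment> \<open>The top prime lies inside \<open>\<mm>\<close>, so P 0 \<subset> P 1 \<subset>
    \<open>\<mm>\<close>, the situation that \<open>pow_notin_PIdl\<close> requires.\<close>
  interpret P2: primeideal "P 2" R using P(1) by simp
  have "\<one> \<notin> P 2" using P2.one_imp_carrier P2.I_notcarr by metis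
  then have "P 2 \<subseteq> \<mm>" using ideal_subset_maximal P2.is_ideal by simp
  then have "P 1 \<subset> \<mm>" using P(2)[of 1] by (simp add: numeral_2_eq_2 less_le_trans)
  moreover have "P 0 \<subset> P 1" using P(2)[of 0] by simp
  ultimately interpret two_generated_local_ring_dim2 R \<mm> x y
    by unfold_locales (use pow_notin_PIdl[OF P(1)[of 0] P(1)[of 1]] in simp)
  show ?thesis using adic_valuation_in_poset by auto
qed

section \<open>Majorants of chains of normalized valuations\<close>

theorem theorem5p9:
  fixes R :: "('a, 'b) ring_scheme" and \<mm> :: "'a set" and S :: "('a \<Rightarrow> ennreal) set"
  assumes "regular_local_ring R \<mm>"
    and "krull_dim R = 2"
    and "S \<subseteq> carrier (valuation_poset R \<mm>)"
    and "totally_ordered_subset (valuation_poset R \<mm>) S"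
    and "order_convex (valuation_poset R \<mm>) S"
  shows "\<exists>\<mu> \<in> carrier (valuation_poset R \<mm>). \<forall>\<nu> \<in> S. \<nu> \<sqsubseteq>\<^bsub>valuation_poset R \<mm>\<^esub> \<mu>"
proof (cases "S = {}")
  case True
  \<comment> \<open>Any valuation bounds the empty chain, so existence of one suffices.\<close>
  then show ?thesis using regular_local_ring.valuation_poset_nonempty[OF assms(1,2)] by auto
next
  case False
  interpret regular_local_ring R \<mm> by fact
  obtain A where A: "A \<subseteq> carrier R" "finite A" "\<mm> = Idl\<^bsub>R\<^esub> A"
    using finetely_gen[OF is_ideal] by auto
  have "restrict (\<lambda>f. SUP \<nu>\<in>S. \<nu> f) (carrier R) \<in> carrier (valuation_poset R \<mm>)"
    using Sup_chain_in_valuation_poset[OF is_cring A assms(3) False assms(4)] .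
  moreover have "\<nu> \<sqsubseteq>\<^bsub>valuation_poset R \<mm>\<^esub> restrict (\<lambda>f. SUP \<nu>\<in>S. \<nu> f) (carrier R)" if "\<nu> \<in> S" for \<nu>
    using that by (auto simp: valuation_poset_def intro: SUP_upper)
  ultimately show ?thesis by blast
qed

end
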